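(* Let $G\subset\mathbf R^d_+$ be a symmetric set, and consider the corresponding spectral set of measures $$\mathcal G=\{\nu\in\mathcal P_2^\circ:\ \lambda(\Sigma_\nu)\in G\}.$$ Then for any $\mu\in\mathcal P_2^\circ$, $$W_2(\mu,\mathcal G)=\inf_{v\in G}\big\|\sqrt{\lambda(\Sigma_\mu)}-\sqrt v\big\|_2 .$$
   Context: $\mathbf R^d_+$ is the set of nonnegative vectors; a set $G\subset\mathbf R^d_+$ is symmetric if it is invariant under all permutations of coordinates. Square roots of vectors are componentwise. $\mathcal P_2^\circ$ is the set of centered Borel probability measures on $\mathbf R^d$ with finite second moment, $\Sigma_\mu=\mathbb E_\mu[xx^\top]$, and $\lambda(A)=(\lambda_1(A),\dots,\lambda_d(A))$ is the vector of eigenvalues of a symmetric matrix in nonincreasing order. $W_2(\mu,\nu)=\min_{\pi\in\Pi(\mu,\nu)}(\mathbb E_{(x,y)\sim\pi}\|x-y\|_2^2)^{1/2}$ over couplings and $W_2(\mu,\mathcal G)=\inf_{\nu\in\mathcal G}W_2(\mu,\nu)$ (with $\inf\emptyset=+\infty$). *)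

theory Defs
  imports "HOL-Probability.Probability"
begin

text \<open>
  Vectors in \<open>R^d\<close> are elements of \<open>real ^ 'd\<close>. The index type is linearly ordered, so that
  ``nonincreasing order'' of the coordinates makes sense.
\<close>

definition symmetric_set :: "(real ^ 'd::finite) set \<Rightarrow> bool" where
  "symmetric_set G \<longleftrightarrow> (\<forall>v\<in>G. \<forall>p. p permutes UNIV \<longrightarrow> (\<chi> i. v $ p i) \<in> G)"

definition nonneg_vectors :: "(real ^ 'd::finite) set" where
  "nonneg_vectors = {v. \<forall>i. 0 \<le> v $ i}"

definition sqrt_vec :: "real ^ 'd::finite \<Rightarrow> real ^ 'd" where
  "sqrt_vec v = (\<chi> i. sqrt (v $ i))"

text \<open>
  Eigenvalues are counted with multiplicity, as roots of the characteristic polynomial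
  \<open>det (t I - A)\<close>; note that \<open>mat t\<close> is \<open>t\<close> times the identity matrix. For symmetric \<open>A\<close>
  there is exactly one such vector; for other matrices the value may be unspecified.
\<close>

definition eigenvalue_vec ::
  "real ^ 'd::{finite,linorder} ^ 'd::{finite,linorder} \<Rightarrow> real ^ 'd::{finite,linorder}" where
  "eigenvalue_vec A = (THE l. (\<forall>i j. i \<le> j \<longrightarrow> l $ j \<le> l $ i) \<and>
     (\<forall>t. det (mat t - A) = (\<Prod>i\<in>UNIV. t - l $ i)))"

text \<open>
  With total mass one, integrability of the squared norm implies integrability of the
  identity, so the mean below is a genuine Bochner integral.
\<close>

definition centered_P2 :: "(real ^ 'd::finite) measure set" where
  "centered_P2 = {\<mu>. prob_space \<mu> \<and> sets \<mu> = sets borel \<and>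
     integrable \<mu> (\<lambda>x. (norm x)\<^sup>2) \<and> (\<integral>x. x \<partial>\<mu>) = 0}"

definition second_moment :: "(real ^ 'd::finite) measure \<Rightarrow> real ^ 'd::finite ^ 'd" where
  "second_moment \<mu> = (\<chi> i j. \<integral>x. x $ i * x $ j \<partial>\<mu>)"

definition couplings ::
  "'a::topological_space measure \<Rightarrow> 'a measure \<Rightarrow> ('a \<times> 'a) measure set" where
  "couplings \<mu> \<nu> = {\<pi>. prob_space \<pi> \<and> sets \<pi> = sets (borel \<Otimes>\<^sub>M borel) \<and>
     distr \<pi> borel fst = \<mu> \<and> distr \<pi> borel snd = \<nu>}"

definition ennsqrt :: "ennreal \<Rightarrow> ennreal" where
  "ennsqrt a = (if a = \<top> then \<top> else ennreal (sqrt (enn2real a)))"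

definition W2 :: "(real ^ 'd::finite) measure \<Rightarrow> (real ^ 'd) measure \<Rightarrow> ennreal" where
  "W2 \<mu> \<nu> = (INF \<pi>\<in>couplings \<mu> \<nu>. ennsqrt (\<integral>\<^sup>+(x, y). ennreal ((norm (x - y))\<^sup>2) \<partial>\<pi>))"

text \<open>The infimum is taken in \<open>ennreal\<close>, hence is \<open>\<top>\<close> for the empty set.\<close>

definition W2_set :: "(real ^ 'd::finite) measure \<Rightarrow> (real ^ 'd) measure set \<Rightarrow> ennreal" where
  "W2_set \<mu> \<G> = (INF \<nu>\<in>\<G>. W2 \<mu> \<nu>)"

definition spectral_measures ::
  "(real ^ 'd::{finite,linorder}) set \<Rightarrow> (real ^ 'd::{finite,linorder}) measure set" where
  "spectral_measures G = {\<nu> \<in> centered_P2. eigenvalue_vec (second_moment \<nu>) \<in> G}"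

end

theory Submission
  imports Defs
begin

text \<open>
  Lower bound: let \<open>a\<close>, \<open>b\<close> be the eigenvalues of the two second-moment matrices, with orthonormal
  eigenbases \<open>u\<close>, \<open>w\<close>. Under a coupling, \<open>E[x \<bullet> y] = \<Sum> q i j * c i j\<close> with \<open>q i j = u i \<bullet> w j\<close> and
  \<open>c i j = E[(x \<bullet> u i) (y \<bullet> w j)] = sqrt (a i) * sqrt (b j) * k i j\<close>. By Bessel's inequality the
  rows and columns of \<open>k\<close> have norm at most 1, so \<open>q * k \<le> (q\<^sup>2 + k\<^sup>2) / 2\<close> bounds \<open>E[x \<bullet> y]\<close> by a
  doubly substochastic combination of the \<open>sqrt (a i) * sqrt (b j)\<close>, hence by the sorted sum
  \<open>\<Sum> sqrt (a i) * sqrt (b i)\<close>.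

  Upper bound: rescale the coordinates of \<open>x\<close> in its own eigenbasis to variances \<open>v i\<close>, using
  independent noise in the directions of vanishing variance; sorting \<open>v\<close> does not increase the
  distance.
\<close>

section \<open>Spectral theorem for symmetric real matrices\<close>

text \<open>A maximizer of \<open>x \<bullet> f x\<close> on the compact unit sphere of
  \<open>S\<close> is an eigenvector, by the first-order condition. Invariance of \<open>S\<close>
  keeps the test direction \<open>y\<close> inside \<open>S\<close>.\<close>

lemma self_adjoint_eigenvector_in_subspace:
  fixes f :: "'a::euclidean_space \<Rightarrow> 'a"
  assumes "linear f" and sa: "\<And>x y. x \<bullet> f y = f x \<bullet> y"
    and S: "subspace S" and inv: "f ` S \<subseteq> S" and "S \<noteq> {0}"
  obtains x c where "x \<in> S" "norm x = 1" "f x = c *\<^sub>R x"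
proof -
  interpret linear f by fact
  let ?K = "S \<inter> sphere 0 1"
  obtain z where z: "z \<in> S" "z \<noteq> 0"
    using S \<open>S \<noteq> {0}\<close> subspace_0 by blast
  have "(1 / norm z) *\<^sub>R z \<in> ?K"
    using z S by (auto simp: subspace_scale)
  moreover have "compact ?K"
    by (intro closed_Int_compact closed_subspace S compact_sphere)
  moreover have "continuous_on ?K (\<lambda>x. x \<bullet> f x)"
    by (intro continuous_intros linear_continuous_on linear_conv_bounded_linear[THEN iffD1] \<open>linear f\<close>)
  ultimately obtain x where x: "x \<in> ?K" and max: "\<And>y. y \<in> ?K \<Longrightarrow> y \<bullet> f y \<le> x \<bullet> f x"
    using continuous_attains_sup[of ?K "\<lambda>x. x \<bullet> f x"] by blast
  define m where "m = x \<bullet> f x"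
  have xx: "x \<bullet> x = 1" and xS: "x \<in> S"
    using x by (auto simp: norm_eq_1)
  have ge: "0 \<le> m * (y \<bullet> y) - y \<bullet> f y" if "y \<in> S" for y
  proof (cases "y = 0")
    case False
    have "(1 / norm y) *\<^sub>R y \<in> ?K"
      using that False S by (auto simp: subspace_scale)
    from max[OF this] have "(y \<bullet> f y) / (norm y)\<^sup>2 \<le> m"
      by (simp add: m_def scale power2_eq_square)
    with False show ?thesis
      by (simp add: field_simps power2_norm_eq_inner)
  qed (simp add: m_def zero)
  define y where "y = m *\<^sub>R x - f x"
  have yS: "y \<in> S"
    unfolding y_def using xS inv S by (intro subspace_diff subspace_scale) auto
  \<comment> \<open>The form \<open>m|z|\<^sup>2 - z\<cdot>f z\<close> is nonnegative on \<open>S\<close> and vanishes at \<open>x\<close>, so its derivative at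
    \<open>x\<close> in the direction \<open>y\<close>, which is \<open>2|y|\<^sup>2\<close>, vanishes.\<close>
  define q where "q = m * (y \<bullet> y) - y \<bullet> f y"
  have quad: "0 \<le> 2 * t * (y \<bullet> y) + t\<^sup>2 * q" for t
  proof -
    have "x + t *\<^sub>R y \<in> S"
      using xS yS S by (intro subspace_add subspace_scale) auto
    from ge[OF this] have "0 \<le> m * ((x + t *\<^sub>R y) \<bullet> (x + t *\<^sub>R y)) - (x + t *\<^sub>R y) \<bullet> f (x + t *\<^sub>R y)" .
    also have "\<dots> = m - x \<bullet> f x + t * (2 * m * (x \<bullet> y) - x \<bullet> f y - y \<bullet> f x) + t\<^sup>2 * q"
      by (simp add: q_def add scale inner_add_left inner_add_right xx inner_commute[of y x]
          power2_eq_square algebra_simps)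
    also have "2 * m * (x \<bullet> y) - x \<bullet> f y - y \<bullet> f x = 2 * (y \<bullet> y)"
      using sa[of x y] by (simp add: y_def inner_diff_left inner_diff_right inner_commute algebra_simps)
    finally show ?thesis
      by (simp add: m_def)
  qed
  have "y \<bullet> y = 0"
  proof (rule ccontr)
    assume "y \<bullet> y \<noteq> 0"
    then have p: "y \<bullet> y > 0" by simp
    have q: "q \<ge> 0" using ge[OF yS] by (simp add: q_def)
    \<comment> \<open>A negative step for which the linear term wins: the quadratic becomes
      \<open>- (t\<^sup>2 * (q + 2))\<close>. Dividing by \<open>q + 1\<close> covers
      \<open>q = 0\<close>.\<close>
    define t where "t = - (y \<bullet> y) / (q + 1)"
    have Y: "y \<bullet> y = - (t * (q + 1))"
      using q by (simp add: t_def)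
    have "2 * t * (y \<bullet> y) + t\<^sup>2 * q = - (t\<^sup>2 * (q + 2))"
      unfolding Y by (simp add: power2_eq_square algebra_simps)
    moreover have "t\<^sup>2 * (q + 2) > 0"
      using p q by (intro mult_pos_pos) (auto simp: t_def)
    ultimately show False using quad[of t] by simp
  qed
  then have "f x = m *\<^sub>R x"
    by (simp add: y_def)
  with xS xx show ?thesis
    by (intro that[of x m]) (auto simp: norm_eq_1)
qed

text \<open>Split off one eigenvector; its orthogonal complement in \<open>S\<close> is invariant
  because \<open>f\<close> is self-adjoint, and the dimension drops by one.\<close>

lemma self_adjoint_orthonormal_eigenbasis:
  fixes f :: "'a::euclidean_space \<Rightarrow> 'a"
  assumes "linear f" and sa: "\<And>x y. x \<bullet> f y = f x \<bullet> y"
    and "subspace S" and "f ` S \<subseteq> S"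
  shows "\<exists>B. finite B \<and> card B = dim S \<and> B \<subseteq> S \<and> pairwise orthogonal B \<and>
    (\<forall>b\<in>B. norm b = 1 \<and> (\<exists>c. f b = c *\<^sub>R b))"
  using assms(3,4)
proof (induction "dim S" arbitrary: S)
  case 0
  then show ?case by (intro exI[of _ "{}"]) auto
next
  case (Suc n)
  have "S \<noteq> {0}" using Suc.hyps(2) by auto
  then obtain x c where x: "x \<in> S" "norm x = 1" "f x = c *\<^sub>R x"
    using self_adjoint_eigenvector_in_subspace[OF assms(1,2) Suc.prems] by blast
  let ?T = "{y \<in> S. \<forall>z\<in>span {x}. orthogonal z y}"
  have T: "?T = {y \<in> S. x \<bullet> y = 0}"
    by (auto simp: span_singleton orthogonal_def intro!: span_base)
  have "span {x} \<subseteq> S"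
    using x Suc.prems(1) by (intro span_minimal) auto
  then have "dim ?T + dim (span {x}) = dim S"
    by (intro dim_subspace_orthogonal_to_vectors Suc.prems) auto
  moreover have "dim (span {x}) = 1"
    using x by (subst dim_span) (metis dim_singleton norm_zero zero_neq_one)
  ultimately have dimT: "n = dim ?T"
    using Suc.hyps(2) by simp
  have subT: "subspace ?T"
    unfolding T using Suc.prems(1)
    by (auto simp: subspace_def inner_add_right)
  have invT: "f ` ?T \<subseteq> ?T"
    unfolding T using Suc.prems(2) x by (auto simp: sa)
  obtain B where B: "finite B" "card B = n" "B \<subseteq> ?T" "pairwise orthogonal B"
    "\<forall>b\<in>B. norm b = 1 \<and> (\<exists>c. f b = c *\<^sub>R b)"
    using Suc.hyps(1)[OF dimT subT invT] dimT by auto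
  have perp: "x \<bullet> b = 0" if "b \<in> B" for b
    using that B(3) T by auto
  have "x \<notin> B"
    using perp[of x] x by auto
  with B x perp Suc.hyps(2) show ?case
    by (intro exI[of _ "insert x B"])
      (auto simp: pairwise_insert orthogonal_def inner_commute)
qed

text \<open>Induction on the largest index, which receives a minimizer of \<open>g\<close> on
  \<open>B\<close>. Serves to order eigenvectors and to find a sorting permutation.\<close>

lemma finite_sorted_enumeration:
  fixes g :: "'b \<Rightarrow> real" and I :: "'i::linorder set"
  assumes "finite I" and "finite B" and "card B = card I"
  shows "\<exists>u. bij_betw u I B \<and> (\<forall>i\<in>I. \<forall>j\<in>I. i \<le> j \<longrightarrow> g (u j) \<le> g (u i))"
  using assms
proof (induction I arbitrary: B rule: finite_linorder_max_induct)
  case empty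
  then show ?case by (auto simp: bij_betw_def)
next
  case (insert b I)
  have bI: "b \<notin> I" using insert.hyps by auto
  then have "B \<noteq> {}" using insert by auto
  then obtain y where y: "y \<in> B" "\<And>z. z \<in> B \<Longrightarrow> g y \<le> g z"
    using insert.prems(1) by (metis arg_min_if_finite(1) arg_min_least)
  have "card (B - {y}) = card I"
    using insert bI y by simp
  then obtain u where u: "bij_betw u I (B - {y})"
    "\<forall>i\<in>I. \<forall>j\<in>I. i \<le> j \<longrightarrow> g (u j) \<le> g (u i)"
    using insert.IH[of "B - {y}"] insert.prems by auto
  let ?u = "u(b := y)"
  have "bij_betw ?u (insert b I) (insert y (B - {y}))"
    using u(1) bI notIn_Un_bij_betw3[of b I ?u "B - {y}"] bij_betw_cong[of I ?u u "B - {y}"]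
    by (metis DiffE Un_insert_right fun_upd_apply insertI1 sup_bot.right_neutral)
  moreover have "insert y (B - {y}) = B"
    using y(1) by auto
  moreover have "g (?u j) \<le> g (?u i)" if "i \<in> insert b I" "j \<in> insert b I" "i \<le> j" for i j
  proof (cases "j = b")
    case True
    have "?u i \<in> B"
      using that(1) u(1) y(1) by (auto simp: bij_betw_def)
    then show ?thesis using True y(2) by simp
  next
    case False
    then have "j \<in> I" "j < b" using that insert.hyps by auto
    then have "i \<in> I" "i \<noteq> b" using that by auto
    then show ?thesis using u(2) that False \<open>j \<in> I\<close> by auto
  qed
  ultimately show ?case by metis
qed

section \<open>Orthonormal bases indexed by the coordinates\<close>

text \<open>The coordinate type is also the index type, so such a family has as many members as the
  dimension and is a basis.\<close>

definition orthonormal_family :: "('d \<Rightarrow> real ^ 'd::finite) \<Rightarrow> bool" where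
  "orthonormal_family u \<longleftrightarrow> (\<forall>i j. u i \<bullet> u j = (if i = j then 1 else 0))"

lemma orthonormal_family_inner:
  "orthonormal_family u \<Longrightarrow> u i \<bullet> u j = (if i = j then 1 else 0)"
  by (simp add: orthonormal_family_def)

lemma orthonormal_family_orthogonal_matrix:
  assumes "orthonormal_family u"
  shows "orthogonal_matrix (\<chi> i. u i)"
  using assms unfolding orthogonal_matrix_orthonormal_rows
  by (auto simp: orthonormal_family_def row_def norm_eq_1 pairwise_def orthogonal_def)

text \<open>The matrix with rows \<open>u i\<close> is orthogonal and so preserves inner
  products.\<close>

lemma orthonormal_family_parseval:
  assumes "orthonormal_family u"
  shows "x \<bullet> y = (\<Sum>i\<in>UNIV. (x \<bullet> u i) * (y \<bullet> u i))"
proof -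
  let ?Q = "\<chi> i. u i"
  have "orthogonal_transformation ((*v) ?Q)"
    using orthonormal_family_orthogonal_matrix[OF assms]
    by (simp add: orthogonal_transformation_matrix)
  then have "x \<bullet> y = (?Q *v x) \<bullet> (?Q *v y)"
    by (simp add: orthogonal_transformation_def)
  also have "\<dots> = (\<Sum>i\<in>UNIV. (x \<bullet> u i) * (y \<bullet> u i))"
    by (simp add: inner_vec_def[of "?Q *v x"] matrix_vector_mult_def)
      (simp add: inner_vec_def mult.commute)
  finally show ?thesis .
qed

lemma orthonormal_family_eqI:
  assumes "orthonormal_family u" and "\<And>i. x \<bullet> u i = y \<bullet> u i"
  shows "x = y"
proof -
  have "(x - y) \<bullet> (x - y) = 0"
    by (subst orthonormal_family_parseval[OF assms(1)]) (simp add: inner_diff_left assms(2))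
  then show ?thesis by simp
qed

text \<open>Eigenvectors are sorted rather than eigenvalues, so multiplicities are kept.\<close>

lemma symmetric_matrix_sorted_eigenbasis:
  fixes A :: "real ^ 'd::{finite,linorder} ^ 'd::{finite,linorder}"
  assumes "transpose A = A"
  obtains u l where "orthonormal_family u" "\<And>i. A *v u i = l i *\<^sub>R u i" "antimono l"
proof -
  have "x \<bullet> (A *v y) = (A *v x) \<bullet> y" for x y
    by (metis assms dot_lmul_matrix transpose_matrix_vector)
  then obtain B where B: "finite B" "card B = dim (UNIV :: (real ^ 'd::{finite,linorder}) set)" "pairwise orthogonal B"
    and eig: "\<forall>b\<in>B. norm b = 1 \<and> (\<exists>c. A *v b = c *\<^sub>R b)"
    using self_adjoint_orthonormal_eigenbasis[of "(*v) A" UNIV] by auto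
  obtain g where g: "\<And>b. b \<in> B \<Longrightarrow> A *v b = g b *\<^sub>R b"
    using eig by metis
  obtain u :: "'d::{finite,linorder} \<Rightarrow> _" where u: "bij_betw u UNIV B" "\<forall>i j. i \<le> j \<longrightarrow> g (u j) \<le> g (u i)"
    using finite_sorted_enumeration[of "UNIV :: 'd::{finite,linorder} set" B g] B(1,2) by auto
  have uB: "u i \<in> B" for i using u(1) by (auto simp: bij_betw_def)
  have "orthonormal_family u"
    unfolding orthonormal_family_def
  proof (intro allI)
    fix i j
    show "u i \<bullet> u j = (if i = j then 1 else 0)"
      using B(3) eig uB[of i] uB[of j] u(1)
      by (auto simp: pairwise_def orthogonal_def norm_eq_1 bij_betw_def dest: injD)
  qed
  moreover have "antimono (g \<circ> u)" using u(2) by (auto simp: antimono_def)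
  ultimately show ?thesis
    using that[of u "g \<circ> u"] g uB by auto
qed

section \<open>The eigenvalue vector\<close>

text \<open>The largest index carries the smallest root, which the polynomial determines; its linear
  factor is then cancelled.\<close>

lemma antitone_roots_unique:
  fixes l m :: "'i::linorder \<Rightarrow> real"
  assumes "finite I" and "antimono_on I l" and "antimono_on I m"
    and "(\<Prod>i\<in>I. [:- l i, 1:]) = (\<Prod>i\<in>I. [:- m i, 1:])"
  shows "\<forall>i\<in>I. l i = m i"
  using assms
proof (induction I rule: finite_linorder_max_induct)
  case (insert b I)
  have bI: "b \<notin> I" using insert.hyps by auto
  \<comment> \<open>Generic, to be used in both directions: \<open>m' b\<close> is a root of the
    product for \<open>l'\<close>, hence some \<open>l' i\<close>, and \<open>l' b\<close> is the
    least of these.\<close>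
  have le: "l' b \<le> m' b"
    if "antimono_on (insert b I) l'" 
      and eq: "(\<Prod>i\<in>insert b I. [:- l' i, 1:]) = (\<Prod>i\<in>insert b I. [:- m' i, 1:])"
    for l' m' :: "'i \<Rightarrow> real"
  proof -
    have "poly (\<Prod>i\<in>insert b I. [:- l' i, 1:]) (m' b) = 0"
      unfolding eq using insert.hyps(1) by (simp add: poly_prod)
    then obtain i where "i \<in> insert b I" "m' b = l' i"
      using insert.hyps(1) by (auto simp: poly_prod)
    then show ?thesis using that(1) insert.hyps
      by (force simp: monotone_on_def)
  qed
  have b: "l b = m b"
    using le[of l m] le[of m l] insert.prems by (metis order_antisym)
  have "(\<Prod>i\<in>I. [:- l i, 1:]) = (\<Prod>i\<in>I. [:- m i, 1:])"
    using insert.prems(3) insert.hyps(1) bI by (simp add: b del: mult_pCons_left)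
  moreover have "antimono_on I l" "antimono_on I m"
    using insert.prems by (auto simp: monotone_on_def)
  ultimately have "\<forall>i\<in>I. l i = m i"
    by (intro insert.IH)
  with b show ?case by simp
qed simp

text \<open>Makes the definite description usable: an eigenbasis yields the characteristic
  polynomial, and \<open>antitone_roots_unique\<close> recovers its sorted roots.\<close>

lemma eigenvalue_vec_eqI:
  fixes A :: "real ^ 'd::{finite,linorder} ^ 'd::{finite,linorder}"
  assumes u: "orthonormal_family u" and eig: "\<And>i. A *v u i = l $ i *\<^sub>R u i"
    and anti: "\<And>i j. i \<le> j \<Longrightarrow> l $ j \<le> l $ i"
  shows "eigenvalue_vec A = l"
proof -
  let ?Q = "\<chi> i. u i"
  have Q: "orthogonal_matrix ?Q"
    by (rule orthonormal_family_orthogonal_matrix[OF u])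
  have char: "det (mat t - A) = (\<Prod>i\<in>UNIV. t - l $ i)" for t
  proof -
    let ?D = "\<chi> i j. if i = j then t - l $ i else 0"
    have "(mat t - A) *v u j = (t - l $ j) *\<^sub>R u j" for j
      by (simp add: matrix_vector_mult_diff_rdistrib eig scaleR_diff_left)
        (simp add: matrix_vector_mult_def mat_def vec_eq_iff if_distrib[of "\<lambda>x. x * _"] cong: if_cong)
    \<comment> \<open>The columns of \<open>transpose ?Q\<close> are the \<open>u j\<close>, so the
      eigenvector equations form one matrix identity.\<close>
    then have "(mat t - A) ** transpose ?Q = transpose ?Q ** ?D"
      by (simp add: matrix_matrix_mult_def transpose_def vec_eq_iff matrix_vector_mult_def
          if_distrib[of "\<lambda>x. _ * x"] mult.commute cong: if_cong)
    then have "det (mat t - A) * det (transpose ?Q) = det (transpose ?Q) * det ?D"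
      by (simp only: det_mul[symmetric])
    moreover have "det (transpose ?Q) \<noteq> 0"
      using det_orthogonal_matrix[OF Q] by (auto simp: det_transpose)
    ultimately have "det (mat t - A) = det ?D" by simp
    then show ?thesis by (simp add: det_diagonal)
  qed
  show ?thesis
    unfolding eigenvalue_vec_def
  proof (rule the_equality)
    fix m :: "real ^ 'd::{finite,linorder}"
    assume m: "(\<forall>i j. i \<le> j \<longrightarrow> m $ j \<le> m $ i) \<and> (\<forall>t. det (mat t - A) = (\<Prod>i\<in>UNIV. t - m $ i))"
    have "poly (\<Prod>i\<in>UNIV. [:- (m $ i), 1:]) = poly (\<Prod>i\<in>UNIV. [:- (l $ i), 1:])"
      using m char by (auto simp: poly_prod fun_eq_iff)
    then have "(\<Prod>i\<in>UNIV. [:- (m $ i), 1:]) = (\<Prod>i\<in>UNIV. [:- (l $ i), 1:])"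
      by (simp add: poly_eq_poly_eq_iff)
    then have "\<forall>i\<in>UNIV. m $ i = l $ i"
      using m anti by (intro antitone_roots_unique) (auto simp: monotone_on_def)
    then show "m = l" by (simp add: vec_eq_iff)
  qed (use char anti in auto)
qed

section \<open>Cross moments and doubly substochastic matrices\<close>

text \<open>A rearrangement inequality, by induction on the largest index instead of a decomposition
  of \<open>D\<close> into permutation matrices.\<close>

lemma doubly_substochastic_sum_le:
  fixes s t :: "'i::linorder \<Rightarrow> real"
  assumes "finite I" and "antimono_on I s" and "antimono_on I t"
    and "\<And>i. i \<in> I \<Longrightarrow> 0 \<le> s i" and "\<And>i. i \<in> I \<Longrightarrow> 0 \<le> t i"
    and "\<And>i j. 0 \<le> D i j"
    and "\<And>i. i \<in> I \<Longrightarrow> (\<Sum>j\<in>I. D i j) \<le> 1" and "\<And>j. j \<in> I \<Longrightarrow> (\<Sum>i\<in>I. D i j) \<le> 1"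
  shows "(\<Sum>i\<in>I. \<Sum>j\<in>I. s i * t j * D i j) \<le> (\<Sum>i\<in>I. s i * t i)"
  using assms
proof (induction I arbitrary: s t rule: finite_linorder_max_induct)
  case (insert b I)
  let ?J = "insert b I"
  have bI: "b \<notin> I" and fin: "finite ?J" using insert.hyps by auto
  \<comment> \<open>Subtract the smallest values \<open>s b\<close>, \<open>t b\<close>; what remains vanishes at \<open>b\<close>.\<close>
  define s' where "s' i = s i - s b" for i
  define t' where "t' i = t i - t b" for i
  have s'0: "s' b = 0" and t'0: "t' b = 0" by (simp_all add: s'_def t'_def)
  have s'nn: "0 \<le> s' i" and t'nn: "0 \<le> t' i" if "i \<in> ?J" for i
    using insert.prems(1,2) insert.hyps that unfolding monotone_on_def s'_def t'_def
    by (auto intro: less_imp_le)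
  have nn: "0 \<le> s b" "0 \<le> t b" using insert.prems(3,4) by auto
  have row: "(\<Sum>j\<in>?J. D i j) \<le> 1" and col: "(\<Sum>k\<in>?J. D k i) \<le> 1" if "i \<in> ?J" for i
    by (rule insert.prems(6)[OF that], rule insert.prems(7)[OF that])
  have IH: "(\<Sum>i\<in>I. \<Sum>j\<in>I. s' i * t' j * D i j) \<le> (\<Sum>i\<in>I. s' i * t' i)"
  proof (rule insert.IH)
    show "antimono_on I s'" "antimono_on I t'"
      using insert.prems(1,2) by (auto simp: monotone_on_def s'_def t'_def)
    show "(\<Sum>j\<in>I. D i j) \<le> 1" "(\<Sum>k\<in>I. D k i) \<le> 1" if "i \<in> I" for i
      using row[of i] col[of i] that bI insert.hyps(1) insert.prems(5)[of i b] insert.prems(5)[of b i]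
      by auto
  qed (use s'nn t'nn insert.prems(5) in auto)
  \<comment> \<open>Expands \<open>s i * t j\<close> around \<open>s b\<close> and
    \<open>t b\<close>. Three of the four products involve only row or column sums of
    \<open>D\<close>; the fourth lives on \<open>I\<close> and falls to the induction
    hypothesis.\<close>
  have "(\<Sum>i\<in>?J. \<Sum>j\<in>?J. s i * t j * D i j) =
      (\<Sum>i\<in>?J. \<Sum>j\<in>?J. s b * t b * D i j + t' j * (s b * D i j) + s' i * (t b * D i j) + s' i * t' j * D i j)"
    by (intro sum.cong refl) (simp add: s'_def t'_def algebra_simps)
  also have "\<dots> = s b * t b * (\<Sum>i\<in>?J. \<Sum>j\<in>?J. D i j)
      + (\<Sum>j\<in>?J. t' j * s b * (\<Sum>i\<in>?J. D i j))
      + (\<Sum>i\<in>?J. s' i * t b * (\<Sum>j\<in>?J. D i j)) + (\<Sum>i\<in>?J. \<Sum>j\<in>?J. s' i * t' j * D i j)"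
  proof -
    have "(\<Sum>i\<in>?J. \<Sum>j\<in>?J. t' j * (s b * D i j)) = (\<Sum>j\<in>?J. t' j * s b * (\<Sum>i\<in>?J. D i j))"
      by (subst sum.swap) (simp only: sum_distrib_left mult.assoc)
    moreover have "(\<Sum>i\<in>?J. \<Sum>j\<in>?J. s' i * (t b * D i j)) = (\<Sum>i\<in>?J. s' i * t b * (\<Sum>j\<in>?J. D i j))"
      by (simp only: sum_distrib_left mult.assoc)
    moreover have "(\<Sum>i\<in>?J. \<Sum>j\<in>?J. s b * t b * D i j) = s b * t b * (\<Sum>i\<in>?J. \<Sum>j\<in>?J. D i j)"
      by (simp only: sum_distrib_left)
    ultimately show ?thesis by (simp only: sum.distrib)
  qed
  also have "(\<Sum>i\<in>?J. \<Sum>j\<in>?J. s' i * t' j * D i j) = (\<Sum>i\<in>I. \<Sum>j\<in>I. s' i * t' j * D i j)"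
    using insert.hyps(1) bI by (simp add: s'0 t'0)
  also have "\<dots> \<le> (\<Sum>i\<in>I. s' i * t' i)" by (rule IH)
  also have "\<dots> = (\<Sum>i\<in>?J. s' i * t' i)"
    using insert.hyps(1) bI by (simp add: s'0)
  also have "s b * t b * (\<Sum>i\<in>?J. \<Sum>j\<in>?J. D i j) \<le> (\<Sum>i\<in>?J. s b * t b)"
    unfolding sum_distrib_left[of _ _ ?J]
    using row nn by (intro sum_mono) (simp only: sum_distrib_left[symmetric] mult_left_le mult_nonneg_nonneg)
  also have "(\<Sum>j\<in>?J. t' j * s b * (\<Sum>i\<in>?J. D i j)) \<le> (\<Sum>j\<in>?J. t' j * s b)"
    using t'nn col nn by (intro sum_mono mult_left_le) auto
  also have "(\<Sum>i\<in>?J. s' i * t b * (\<Sum>j\<in>?J. D i j)) \<le> (\<Sum>i\<in>?J. s' i * t b)"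
    using s'nn row nn by (intro sum_mono mult_left_le) auto
  also have "(\<Sum>i\<in>?J. s b * t b) + (\<Sum>j\<in>?J. t' j * s b) + (\<Sum>i\<in>?J. s' i * t b) + (\<Sum>i\<in>?J. s' i * t' i)
      = (\<Sum>i\<in>?J. s i * t i)"
    unfolding sum.distrib[symmetric]
    by (intro sum.cong refl) (simp add: s'_def t'_def algebra_simps)
  finally show ?case by simp
qed simp

section \<open>Bessel's inequality and correlation matrices\<close>

text \<open>The residual of projecting \<open>f\<close> onto the span of the \<open>Y i\<close> has
  nonnegative second moment.\<close>

lemma bessel_integral:
  fixes Y :: "'d::finite \<Rightarrow> 'a \<Rightarrow> real"
  assumes "integrable M (\<lambda>x. f x * f x)" and "\<And>i. integrable M (\<lambda>x. f x * Y i x)"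
    and "\<And>i j. integrable M (\<lambda>x. Y i x * Y j x)"
    and Y: "\<And>i j. (\<integral>x. Y i x * Y j x \<partial>M) = (if i = j then b i else 0)"
  shows "(\<Sum>i\<in>UNIV. (\<integral>x. f x * Y i x \<partial>M)\<^sup>2 / b i) \<le> (\<integral>x. f x * f x \<partial>M)"
proof -
  define c where "c i = (\<integral>x. f x * Y i x \<partial>M)" for i
  \<comment> \<open>Projection coefficients. If \<open>b i = 0\<close>, division by zero gives
    \<open>r i = 0\<close>, and the matching term of the claim is 0 too.\<close>
  define r where "r i = c i / b i" for i
  have "0 \<le> (\<integral>x. (f x - (\<Sum>i\<in>UNIV. r i * Y i x))\<^sup>2 \<partial>M)"
    by simp
  also have "\<dots> = (\<integral>x. f x * f x - 2 * (\<Sum>i\<in>UNIV. r i * (f x * Y i x))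
      + (\<Sum>i\<in>UNIV. \<Sum>j\<in>UNIV. r i * r j * (Y i x * Y j x)) \<partial>M)"
    by (intro Bochner_Integration.integral_cong refl)
      (simp add: power2_eq_square algebra_simps sum_product sum_distrib_left)
  also have "\<dots> = (\<integral>x. f x * f x \<partial>M) - 2 * (\<Sum>i\<in>UNIV. r i * c i)
      + (\<Sum>i\<in>UNIV. \<Sum>j\<in>UNIV. r i * r j * (if i = j then b i else 0))"
    using assms(1-3) by (simp add: c_def Y)
  also have "\<dots> = (\<integral>x. f x * f x \<partial>M) - (\<Sum>i\<in>UNIV. (c i)\<^sup>2 / b i)"
  proof -
    have "(\<Sum>i\<in>UNIV. \<Sum>j\<in>UNIV. r i * r j * (if i = j then b i else 0)) = (\<Sum>i\<in>UNIV. r i * r i * b i)"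
      by (simp add: if_distrib[of "\<lambda>x. _ * x"] cong: if_cong)
    also have "\<dots> = (\<Sum>i\<in>UNIV. r i * c i)"
      by (intro sum.cong refl) (simp add: r_def)
    also have "\<dots> = (\<Sum>i\<in>UNIV. (c i)\<^sup>2 / b i)"
      by (simp add: r_def power2_eq_square)
    finally show ?thesis
      by (simp add: r_def power2_eq_square)
  qed
  finally show ?thesis by (simp add: c_def)
qed

text \<open>\<open>f\<close> vanishes almost everywhere; this settles directions of zero
  variance.\<close>

lemma integral_mult_eq_0_if_square:
  fixes f g :: "'a \<Rightarrow> real"
  assumes "integrable M (\<lambda>x. f x * f x)" and "(\<integral>x. f x * f x \<partial>M) = 0"
  shows "(\<integral>x. f x * g x \<partial>M) = 0"
proof -
  have "AE x in M. f x * f x = 0"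
    using assms by (subst (asm) integral_nonneg_eq_0_iff_AE) auto
  then show ?thesis
    by (intro integral_eq_zero_AE) auto
qed

text \<open>\<open>q\<close> is later the overlap matrix of two eigenbases; like the correlation
  matrix \<open>k\<close>, it has rows and columns of norm at most 1.\<close>

lemma cross_moment_bound:
  fixes X Y :: "'d::{finite,linorder} \<Rightarrow> 'a \<Rightarrow> real"
  assumes iXX: "\<And>i j. integrable M (\<lambda>x. X i x * X j x)"
    and iXY: "\<And>i j. integrable M (\<lambda>x. X i x * Y j x)"
    and iYY: "\<And>i j. integrable M (\<lambda>x. Y i x * Y j x)"
    and X: "\<And>i j. (\<integral>x. X i x * X j x \<partial>M) = (if i = j then a i else 0)"
    and Y: "\<And>i j. (\<integral>x. Y i x * Y j x \<partial>M) = (if i = j then b i else 0)"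
    and "antimono a" and "antimono b"
    and "\<And>i. (\<Sum>j\<in>UNIV. (q i j)\<^sup>2) \<le> 1" and "\<And>j. (\<Sum>i\<in>UNIV. (q i j)\<^sup>2) \<le> 1"
  shows "(\<Sum>i\<in>UNIV. \<Sum>j\<in>UNIV. q i j * (\<integral>x. X i x * Y j x \<partial>M)) \<le> (\<Sum>i\<in>UNIV. sqrt (a i) * sqrt (b i))"
proof -
  define c where "c i j = (\<integral>x. X i x * Y j x \<partial>M)" for i j
  \<comment> \<open>Correlations, set to 0 by division where a variance vanishes. There
    \<open>c i j\<close> is 0 as well, by \<open>ca\<close> and \<open>cb\<close>, so the
    factorization \<open>c\<close> always holds.\<close>
  define k where "k i j = c i j / (sqrt (a i) * sqrt (b j))" for i j
  have a: "0 \<le> a i" and b: "0 \<le> b i" for i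
    using X[of i i] Y[of i i] by (metis Bochner_Integration.integral_nonneg zero_le_square)+
  have ca: "c i j = 0" if "a i = 0" for i j
    unfolding c_def by (rule integral_mult_eq_0_if_square[OF iXX]) (simp add: X that)
  have c_swap: "c i j = (\<integral>x. Y j x * X i x \<partial>M)" for i j
    by (simp only: c_def mult.commute)
  have cb: "c i j = 0" if "b j = 0" for i j
    unfolding c_swap by (rule integral_mult_eq_0_if_square[OF iYY]) (simp add: Y that)
  have iYX: "integrable M (\<lambda>x. Y i x * X j x)" for i j
    using iXY[of j i] by (simp only: mult.commute)
  have c: "c i j = sqrt (a i) * sqrt (b j) * k i j" for i j
    using ca[of i j] cb[of j i] by (auto simp: k_def)
  have row: "(\<Sum>j\<in>UNIV. (k i j)\<^sup>2) \<le> 1" for i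
  proof -
    have "(\<Sum>j\<in>UNIV. (k i j)\<^sup>2) = (\<Sum>j\<in>UNIV. (c i j)\<^sup>2 / b j) / a i"
      using a b by (simp add: k_def power_divide power_mult_distrib sum_divide_distrib mult.commute)
    \<comment> \<open>This quotient is 1, or 0 if \<open>a i = 0\<close>; both cases are
      covered.\<close>
    also have "\<dots> \<le> a i / a i"
      using bessel_integral[of M "X i" Y b, OF iXX iXY iYY Y] a
      by (intro divide_right_mono) (simp_all add: c_def X)
    also have "\<dots> \<le> 1" by simp
    finally show ?thesis .
  qed
  have col: "(\<Sum>i\<in>UNIV. (k i j)\<^sup>2) \<le> 1" for j
  proof -
    have "(\<Sum>i\<in>UNIV. (k i j)\<^sup>2) = (\<Sum>i\<in>UNIV. (c i j)\<^sup>2 / a i) / b j"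
      using a b by (simp add: k_def power_divide power_mult_distrib sum_divide_distrib mult.commute)
    also have "\<dots> \<le> b j / b j"
      using bessel_integral[of M "Y j" X a, OF iYY iYX iXX X] b
      by (intro divide_right_mono) (simp_all add: c_swap Y)
    also have "\<dots> \<le> 1" by simp
    finally show ?thesis .
  qed
  define D where "D i j = ((q i j)\<^sup>2 + (k i j)\<^sup>2) / 2" for i j
  have "(\<Sum>i\<in>UNIV. \<Sum>j\<in>UNIV. q i j * c i j) \<le> (\<Sum>i\<in>UNIV. \<Sum>j\<in>UNIV. sqrt (a i) * sqrt (b j) * D i j)"
  proof (intro sum_mono)
    fix i j
    have "q i j * k i j \<le> D i j"
      using sum_squares_bound[of "q i j" "k i j"] by (simp add: D_def)
    then have "sqrt (a i) * sqrt (b j) * (q i j * k i j) \<le> sqrt (a i) * sqrt (b j) * D i j"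
      by (intro mult_left_mono) (auto simp: a b)
    then show "q i j * c i j \<le> sqrt (a i) * sqrt (b j) * D i j"
      by (simp add: c mult_ac)
  qed
  also have "\<dots> \<le> (\<Sum>i\<in>UNIV. sqrt (a i) * sqrt (b i))"
  proof (rule doubly_substochastic_sum_le)
    show "(\<Sum>j\<in>UNIV. D i j) \<le> 1" for i
      using row[of i] assms(8)[of i] by (simp add: D_def sum_divide_distrib[symmetric] sum.distrib)
    show "(\<Sum>i\<in>UNIV. D i j) \<le> 1" for j
      using col[of j] assms(9)[of j] by (simp add: D_def sum_divide_distrib[symmetric] sum.distrib)
  qed (use \<open>antimono a\<close> \<open>antimono b\<close> a b in \<open>auto simp: monotone_on_def D_def\<close>)
  finally show ?thesis by (simp add: c_def)
qed

section \<open>Second moments\<close>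

text \<open>Cauchy-Schwarz bounds the product by a multiple of the squared norms. Two separate maps
  are allowed for the sake of the cross terms of a coupling.\<close>

lemma integrable_inner_mult_inner:
  fixes x y :: "'a \<Rightarrow> 'b::euclidean_space"
  assumes [measurable]: "x \<in> borel_measurable M" "y \<in> borel_measurable M"
    and "integrable M (\<lambda>p. (norm (x p))\<^sup>2)" and "integrable M (\<lambda>p. (norm (y p))\<^sup>2)"
  shows "integrable M (\<lambda>p. (x p \<bullet> u) * (y p \<bullet> w))"
proof (rule Bochner_Integration.integrable_bound)
  show "integrable M (\<lambda>p. norm u * norm w * ((norm (x p))\<^sup>2 + (norm (y p))\<^sup>2))"
    using assms(3,4) by simp
  show "AE p in M. norm ((x p \<bullet> u) * (y p \<bullet> w)) \<le> norm (norm u * norm w * ((norm (x p))\<^sup>2 + (norm (y p))\<^sup>2))"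
  proof (rule AE_I2)
    fix p
    have "\<bar>x p \<bullet> u\<bar> * \<bar>y p \<bullet> w\<bar> \<le> (norm (x p) * norm u) * (norm (y p) * norm w)"
      by (intro mult_mono Cauchy_Schwarz_ineq2) auto
    also have "\<dots> = norm u * norm w * (norm (x p) * norm (y p))"
      by simp
    also have "\<dots> \<le> norm u * norm w * ((norm (x p))\<^sup>2 + (norm (y p))\<^sup>2)"
    proof (intro mult_left_mono)
      show "norm (x p) * norm (y p) \<le> (norm (x p))\<^sup>2 + (norm (y p))\<^sup>2"
        using sum_squares_bound[of "norm (x p)" "norm (y p)"]
          mult_nonneg_nonneg[OF norm_ge_zero norm_ge_zero, of "x p" "y p"]
        by linarith
    qed simp
    finally show "norm ((x p \<bullet> u) * (y p \<bullet> w)) \<le> norm (norm u * norm w * ((norm (x p))\<^sup>2 + (norm (y p))\<^sup>2))"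
      by (simp add: abs_mult)
  qed
qed measurable

lemma centered_P2_integrable_inner_mult:
  assumes "\<mu> \<in> centered_P2"
  shows "integrable \<mu> (\<lambda>x. (x \<bullet> u) * (x \<bullet> w))"
proof -
  have [measurable_cong]: "sets \<mu> = sets borel" and "integrable \<mu> (\<lambda>x. (norm x)\<^sup>2)"
    using assms by (auto simp: centered_P2_def)
  then show ?thesis by (intro integrable_inner_mult_inner) auto
qed

lemma integral_inner_mult_second_moment:
  assumes "\<mu> \<in> centered_P2"
  shows "(\<integral>x. (x \<bullet> u) * (x \<bullet> w) \<partial>\<mu>) = u \<bullet> (second_moment \<mu> *v w)"
proof -
  have int: "integrable \<mu> (\<lambda>x. x $ i * x $ j)" for i j
    using centered_P2_integrable_inner_mult[OF assms, of "axis i 1" "axis j 1"]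
    by (simp add: inner_axis)
  have "(\<integral>x. (x \<bullet> u) * (x \<bullet> w) \<partial>\<mu>) = (\<integral>x. (\<Sum>i\<in>UNIV. \<Sum>j\<in>UNIV. u $ i * w $ j * (x $ i * x $ j)) \<partial>\<mu>)"
    by (intro Bochner_Integration.integral_cong refl) (simp add: inner_vec_def sum_product mult_ac)
  also have "\<dots> = (\<Sum>i\<in>UNIV. \<Sum>j\<in>UNIV. u $ i * w $ j * (\<integral>x. x $ i * x $ j \<partial>\<mu>))"
    using int by simp
  also have "\<dots> = u \<bullet> (second_moment \<mu> *v w)"
    by (simp add: inner_vec_def matrix_vector_mult_def second_moment_def sum_distrib_left mult_ac)
  finally show ?thesis .
qed

text \<open>The form in which both bounds use the spectral theorem: coordinates in an eigenbasis are
  uncorrelated, with the eigenvalues as variances.\<close>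

lemma second_moment_eigenbasis:
  fixes \<mu> :: "(real ^ 'd::{finite,linorder}) measure"
  assumes "\<mu> \<in> centered_P2"
  obtains u where "orthonormal_family u"
    and "\<And>i j. (\<integral>x. (x \<bullet> u i) * (x \<bullet> u j) \<partial>\<mu>) = (if i = j then eigenvalue_vec (second_moment \<mu>) $ i else 0)"
    and "\<And>i j. i \<le> j \<Longrightarrow> eigenvalue_vec (second_moment \<mu>) $ j \<le> eigenvalue_vec (second_moment \<mu>) $ i"
proof -
  let ?A = "second_moment \<mu>"
  have "transpose ?A = ?A"
    by (simp add: second_moment_def transpose_def mult.commute)
  then obtain u l where u: "orthonormal_family u" "\<And>i. ?A *v u i = l i *\<^sub>R u i" "antimono l"
    using symmetric_matrix_sorted_eigenbasis by blast
  have "eigenvalue_vec ?A = (\<chi> i. l i)"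
    using u by (intro eigenvalue_vec_eqI[of u]) (auto simp: antimono_def)
  with u show ?thesis
    by (intro that[of u])
      (auto simp: integral_inner_mult_second_moment[OF assms] orthonormal_family_inner antimono_def)
qed

text \<open>Converse of \<open>second_moment_eigenbasis\<close>, for reading off the spectrum of a
  constructed measure: uncorrelated coordinates force each \<open>u j\<close> to be an
  eigenvector.\<close>

lemma eigenvalue_vec_second_momentI:
  fixes \<mu> :: "(real ^ 'd::{finite,linorder}) measure"
  assumes "\<mu> \<in> centered_P2" and "orthonormal_family u"
    and "\<And>i j. (\<integral>x. (x \<bullet> u i) * (x \<bullet> u j) \<partial>\<mu>) = (if i = j then l $ i else 0)"
    and "\<And>i j. i \<le> j \<Longrightarrow> l $ j \<le> l $ i"
  shows "eigenvalue_vec (second_moment \<mu>) = l"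
proof (rule eigenvalue_vec_eqI[OF assms(2)])
  show "second_moment \<mu> *v u j = l $ j *\<^sub>R u j" for j
  proof (rule orthonormal_family_eqI[OF assms(2)])
    fix i
    have "(second_moment \<mu> *v u j) \<bullet> u i = (if i = j then l $ i else 0)"
      using assms(3)[of i j] integral_inner_mult_second_moment[OF assms(1), of "u i" "u j"]
      by (simp add: inner_commute)
    then show "(second_moment \<mu> *v u j) \<bullet> u i = (l $ j *\<^sub>R u j) \<bullet> u i"
      by (simp add: orthonormal_family_inner[OF assms(2)])
  qed
qed (fact assms(4))

section \<open>The lower bound\<close>

lemma ennsqrt_ennreal: "0 \<le> r \<Longrightarrow> ennsqrt (ennreal r) = ennreal (sqrt r)"
  by (simp add: ennsqrt_def)

lemma eigenvalue_vec_second_moment: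
  fixes \<mu> :: "(real ^ 'd::{finite,linorder}) measure"
  assumes "\<mu> \<in> centered_P2"
  shows eigenvalue_vec_second_moment_nonneg: "0 \<le> eigenvalue_vec (second_moment \<mu>) $ i"
    and eigenvalue_vec_second_moment_sorted:
      "i \<le> j \<Longrightarrow> eigenvalue_vec (second_moment \<mu>) $ j \<le> eigenvalue_vec (second_moment \<mu>) $ i"
proof -
  obtain u where u: "orthonormal_family u"
    and E: "\<And>i j. (\<integral>x. (x \<bullet> u i) * (x \<bullet> u j) \<partial>\<mu>) = (if i = j then eigenvalue_vec (second_moment \<mu>) $ i else 0)"
    and sorted: "\<And>i j. i \<le> j \<Longrightarrow> eigenvalue_vec (second_moment \<mu>) $ j \<le> eigenvalue_vec (second_moment \<mu>) $ i"
    using second_moment_eigenbasis[OF assms] by blast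
  have "0 \<le> (\<integral>x. (x \<bullet> u i) * (x \<bullet> u i) \<partial>\<mu>)"
    by (rule Bochner_Integration.integral_nonneg) simp
  then show "0 \<le> eigenvalue_vec (second_moment \<mu>) $ i"
    by (simp add: E)
  show "eigenvalue_vec (second_moment \<mu>) $ j \<le> eigenvalue_vec (second_moment \<mu>) $ i" if "i \<le> j"
    by (rule sorted[OF that])
qed

lemma norm_sqrt_vec_diff_square:
  "(norm (sqrt_vec a - sqrt_vec b))\<^sup>2 = (\<Sum>i\<in>UNIV. (sqrt (a $ i) - sqrt (b $ i))\<^sup>2)"
  unfolding power2_norm_eq_inner by (simp add: inner_vec_def sqrt_vec_def power2_eq_square)

text \<open>The marginals fix the second moments of \<open>x\<close> and \<open>y\<close> as the
  sums of their eigenvalues, so only the mean of \<open>x \<bullet> y\<close> depends on the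
  coupling; \<open>cross_moment_bound\<close> controls it.\<close>

lemma W2_ge_eigenvalue_distance:
  fixes \<mu> \<nu> :: "(real ^ 'd::{finite,linorder}) measure"
  assumes \<mu>: "\<mu> \<in> centered_P2" and \<nu>: "\<nu> \<in> centered_P2"
  shows "ennreal (norm (sqrt_vec (eigenvalue_vec (second_moment \<mu>)) - sqrt_vec (eigenvalue_vec (second_moment \<nu>))))
    \<le> W2 \<mu> \<nu>"
  unfolding W2_def
proof (rule INF_greatest)
  let ?a = "eigenvalue_vec (second_moment \<mu>)" and ?b = "eigenvalue_vec (second_moment \<nu>)"
  fix \<pi> assume \<pi>: "\<pi> \<in> couplings \<mu> \<nu>"
  have [measurable_cong]: "sets \<pi> = sets (borel \<Otimes>\<^sub>M borel)"
    and dfst: "\<mu> = distr \<pi> borel fst" and dsnd: "\<nu> = distr \<pi> borel snd"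
    using \<pi> by (auto simp: couplings_def)
  have int: "integrable \<pi> (\<lambda>p. (norm (fst p))\<^sup>2)" "integrable \<pi> (\<lambda>p. (norm (snd p))\<^sup>2)"
    using \<mu> \<nu> unfolding centered_P2_def
    by (auto simp: dfst integrable_distr_eq, auto simp: dsnd integrable_distr_eq)
  note int_inner = integrable_inner_mult_inner[of fst \<pi> fst, OF _ _ int(1) int(1)]
    integrable_inner_mult_inner[of fst \<pi> snd, OF _ _ int(1) int(2)]
    integrable_inner_mult_inner[of snd \<pi> snd, OF _ _ int(2) int(2)]
  obtain u where u: "orthonormal_family u"
    and Eu: "\<And>i j. (\<integral>x. (x \<bullet> u i) * (x \<bullet> u j) \<partial>\<mu>) = (if i = j then ?a $ i else 0)"
    and au: "\<And>i j. i \<le> j \<Longrightarrow> ?a $ j \<le> ?a $ i"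
    using second_moment_eigenbasis[OF \<mu>] by blast
  obtain w where w: "orthonormal_family w"
    and Ew: "\<And>i j. (\<integral>x. (x \<bullet> w i) * (x \<bullet> w j) \<partial>\<nu>) = (if i = j then ?b $ i else 0)"
    and aw: "\<And>i j. i \<le> j \<Longrightarrow> ?b $ j \<le> ?b $ i"
    using second_moment_eigenbasis[OF \<nu>] by blast
  have Eu': "(\<integral>p. (fst p \<bullet> u i) * (fst p \<bullet> u j) \<partial>\<pi>) = (if i = j then ?a $ i else 0)" for i j
    unfolding Eu[symmetric] by (subst dfst, subst integral_distr) auto
  have Ew': "(\<integral>p. (snd p \<bullet> w i) * (snd p \<bullet> w j) \<partial>\<pi>) = (if i = j then ?b $ i else 0)" for i j
    unfolding Ew[symmetric] by (subst dsnd, subst integral_distr) auto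
  have ann: "0 \<le> ?a $ i" for i
    by (rule eigenvalue_vec_second_moment_nonneg[OF \<mu>])
  have bnn: "0 \<le> ?b $ i" for i
    by (rule eigenvalue_vec_second_moment_nonneg[OF \<nu>])
  let ?q = "\<lambda>i j. u i \<bullet> w j"
  have q_row: "(\<Sum>j\<in>UNIV. (?q i j)\<^sup>2) \<le> 1" for i
    using orthonormal_family_parseval[OF w, of "u i" "u i"]
    by (simp add: orthonormal_family_inner[OF u] power2_eq_square)
  have q_col: "(\<Sum>i\<in>UNIV. (?q i j)\<^sup>2) \<le> 1" for j
    using orthonormal_family_parseval[OF u, of "w j" "w j"]
    by (simp add: orthonormal_family_inner[OF w] power2_eq_square inner_commute)
  have cross: "(\<Sum>i\<in>UNIV. \<Sum>j\<in>UNIV. ?q i j * (\<integral>p. (fst p \<bullet> u i) * (snd p \<bullet> w j) \<partial>\<pi>))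
      \<le> (\<Sum>i\<in>UNIV. sqrt (?a $ i) * sqrt (?b $ i))"
    by (rule cross_moment_bound[OF _ _ _ Eu' Ew' _ _ q_row q_col])
      (use au aw in \<open>auto intro!: int_inner simp: antimono_def\<close>)
  \<comment> \<open>\<open>x\<close> is expanded in \<open>u\<close> and \<open>y\<close> in
    \<open>w\<close>, each basis diagonalizing its own marginal; the overlaps \<open>?q\<close>
    enter through the cross term.\<close>
  have expand: "(norm (fst p - snd p))\<^sup>2 = (\<Sum>i\<in>UNIV. (fst p \<bullet> u i) * (fst p \<bullet> u i))
      + (\<Sum>i\<in>UNIV. (snd p \<bullet> w i) * (snd p \<bullet> w i))
      - 2 * (\<Sum>i\<in>UNIV. \<Sum>j\<in>UNIV. ?q i j * ((fst p \<bullet> u i) * (snd p \<bullet> w j)))" for p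
  proof -
    have "fst p \<bullet> snd p = (\<Sum>i\<in>UNIV. (fst p \<bullet> u i) * (\<Sum>j\<in>UNIV. (snd p \<bullet> w j) * (u i \<bullet> w j)))"
      by (subst orthonormal_family_parseval[OF u]) (simp add: orthonormal_family_parseval[OF w, symmetric])
    also have "\<dots> = (\<Sum>i\<in>UNIV. \<Sum>j\<in>UNIV. ?q i j * ((fst p \<bullet> u i) * (snd p \<bullet> w j)))"
      by (simp add: sum_distrib_left mult_ac)
    finally show ?thesis
      using orthonormal_family_parseval[OF u, of "fst p" "fst p"] orthonormal_family_parseval[OF w, of "snd p" "snd p"]
      by (simp add: power2_norm_eq_inner inner_diff_left inner_diff_right inner_commute)
  qed
  have int_diff: "integrable \<pi> (\<lambda>p. (norm (fst p - snd p))\<^sup>2)"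
    unfolding expand
    by (intro Bochner_Integration.integrable_add Bochner_Integration.integrable_diff
        Bochner_Integration.integrable_sum integrable_mult_right int_inner) auto
  have "(norm (sqrt_vec ?a - sqrt_vec ?b))\<^sup>2 = (\<Sum>i\<in>UNIV. (sqrt (?a $ i) - sqrt (?b $ i))\<^sup>2)"
    by (rule norm_sqrt_vec_diff_square)
  also have "\<dots> = (\<Sum>i\<in>UNIV. ?a $ i + ?b $ i - 2 * (sqrt (?a $ i) * sqrt (?b $ i)))"
    using ann bnn by (simp add: power2_diff mult.assoc)
  also have "\<dots> = (\<Sum>i\<in>UNIV. ?a $ i) + (\<Sum>i\<in>UNIV. ?b $ i) - 2 * (\<Sum>i\<in>UNIV. sqrt (?a $ i) * sqrt (?b $ i))"
    by (simp add: sum.distrib sum_subtractf sum_distrib_left)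
  also have "\<dots> \<le> (\<Sum>i\<in>UNIV. ?a $ i) + (\<Sum>i\<in>UNIV. ?b $ i)
      - 2 * (\<Sum>i\<in>UNIV. \<Sum>j\<in>UNIV. ?q i j * (\<integral>p. (fst p \<bullet> u i) * (snd p \<bullet> w j) \<partial>\<pi>))"
    using cross by simp
  also have "\<dots> = (\<integral>p. (norm (fst p - snd p))\<^sup>2 \<partial>\<pi>)"
    unfolding expand using int_inner by (simp add: Eu' Ew')
  finally have "norm (sqrt_vec ?a - sqrt_vec ?b) \<le> sqrt (\<integral>p. (norm (fst p - snd p))\<^sup>2 \<partial>\<pi>)"
    by (rule real_le_rsqrt)
  moreover have "(\<integral>\<^sup>+(x, y). ennreal ((norm (x - y))\<^sup>2) \<partial>\<pi>) = ennreal (\<integral>p. (norm (fst p - snd p))\<^sup>2 \<partial>\<pi>)"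
    unfolding case_prod_beta using int_diff by (intro nn_integral_eq_integral) auto
  ultimately show "ennreal (norm (sqrt_vec ?a - sqrt_vec ?b))
      \<le> ennsqrt (\<integral>\<^sup>+(x, y). ennreal ((norm (x - y))\<^sup>2) \<partial>\<pi>)"
    by (simp add: ennsqrt_ennreal ennreal_leI)
qed

section \<open>The upper bound\<close>

text \<open>Independence via Fubini; a constant factor gives functions of one component.\<close>

lemma (in pair_prob_space) product_expectation:
  fixes f g :: "_ \<Rightarrow> real"
  assumes f: "integrable M1 f" and g: "integrable M2 g"
  shows "integrable (M1 \<Otimes>\<^sub>M M2) (\<lambda>p. f (fst p) * g (snd p))"
    and "(\<integral>p. f (fst p) * g (snd p) \<partial>(M1 \<Otimes>\<^sub>M M2)) = (\<integral>x. f x \<partial>M1) * (\<integral>y. g y \<partial>M2)"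
proof -
  have [measurable]: "f \<in> borel_measurable M1" "g \<in> borel_measurable M2"
    using f g by auto
  show int: "integrable (M1 \<Otimes>\<^sub>M M2) (\<lambda>p. f (fst p) * g (snd p))"
    by (rule Fubini_integrable) (use f g in \<open>auto simp: abs_mult\<close>)
  show "(\<integral>p. f (fst p) * g (snd p) \<partial>(M1 \<Otimes>\<^sub>M M2)) = (\<integral>x. f x \<partial>M1) * (\<integral>y. g y \<partial>M2)"
    using integral_fst'[OF int] by simp
qed

text \<open>Under the uniform law one component, drawn at random, is a scaled random sign and the
  others vanish. The factor \<open>sqrt (CARD('d))\<close> makes variances 1; distinct components
  are never nonzero together, hence uncorrelated.\<close>

definition sign_noise :: "'d::finite \<Rightarrow> 'd \<times> bool \<Rightarrow> real" where
  "sign_noise i \<omega> = (if fst \<omega> = i then (if snd \<omega> then 1 else - 1) * sqrt (CARD('d)) else 0)"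

lemma expectation_pmf_of_set_prod_bool:
  fixes f :: "'d::finite \<times> bool \<Rightarrow> real"
  shows "(\<integral>\<omega>. f \<omega> \<partial>measure_pmf (pmf_of_set UNIV)) = (\<Sum>k\<in>UNIV. f (k, True) + f (k, False)) / (2 * CARD('d))"
proof -
  have "(\<Sum>\<omega>\<in>UNIV. f \<omega>) = (\<Sum>k\<in>UNIV. \<Sum>s\<in>UNIV. f (k, s))"
    by (simp add: sum.cartesian_product UNIV_Times_UNIV)
  then show ?thesis
    by (simp add: integral_pmf_of_set UNIV_bool card_prod add.commute)
qed

lemma sign_noise_mean: "(\<integral>\<omega>. sign_noise i \<omega> \<partial>measure_pmf (pmf_of_set UNIV)) = 0"
  by (subst expectation_pmf_of_set_prod_bool) (auto simp: sign_noise_def intro!: sum.neutral)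

lemma sign_noise_covariance:
  fixes i j :: "'d::finite"
  shows "(\<integral>\<omega>. sign_noise i \<omega> * sign_noise j \<omega> \<partial>measure_pmf (pmf_of_set UNIV)) = (if i = j then 1 else 0)"
proof -
  have "(\<Sum>k\<in>UNIV. sign_noise i (k, True) * sign_noise j (k, True) + sign_noise i (k, False) * sign_noise j (k, False))
      = (\<Sum>k\<in>UNIV. if k = i then (if i = j then 2 * real CARD('d) else 0) else 0)"
    by (intro sum.cong refl) (auto simp: sign_noise_def)
  then show ?thesis
    by (subst expectation_pmf_of_set_prod_bool) simp
qed

text \<open>The law of \<open>(x, T)\<close> is itself the coupling. Extra randomness is unavoidable
  in general, since a map of \<open>x\<close> alone sends a point mass to a point mass.\<close>

lemma exists_measure_with_eigenvalues:
  fixes \<mu> :: "(real ^ 'd::{finite,linorder}) measure" and v :: "real ^ 'd::{finite,linorder}"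
  assumes \<mu>: "\<mu> \<in> centered_P2" and v: "\<And>i. 0 \<le> v $ i" and sorted: "\<And>i j. i \<le> j \<Longrightarrow> v $ j \<le> v $ i"
  shows "\<exists>\<nu>\<in>centered_P2. eigenvalue_vec (second_moment \<nu>) = v \<and>
    W2 \<mu> \<nu> \<le> ennreal (norm (sqrt_vec (eigenvalue_vec (second_moment \<mu>)) - sqrt_vec v))"
proof -
  let ?a = "eigenvalue_vec (second_moment \<mu>)"
  obtain u where u: "orthonormal_family u"
    and Eu: "\<And>i j. (\<integral>x. (x \<bullet> u i) * (x \<bullet> u j) \<partial>\<mu>) = (if i = j then ?a $ i else 0)"
    by (rule second_moment_eigenbasis[OF \<mu>]) (rule that)
  have ann: "0 \<le> ?a $ i" for i
    by (rule eigenvalue_vec_second_moment_nonneg[OF \<mu>])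
  have sets_\<mu>[measurable_cong]: "sets \<mu> = sets borel" and "prob_space \<mu>"
    and sq: "integrable \<mu> (\<lambda>x. (norm x)\<^sup>2)" and mean: "(\<integral>x. x \<partial>\<mu>) = 0"
    using \<mu> by (auto simp: centered_P2_def)
  interpret \<mu>: prob_space \<mu> by fact
  have id: "integrable \<mu> (\<lambda>x. x)"
  proof (rule Bochner_Integration.integrable_bound)
    show "integrable \<mu> (\<lambda>x. 1 + (norm x)\<^sup>2)" using sq by simp
    have "norm x \<le> 1 + (norm x)\<^sup>2" for x :: "real ^ 'd::{finite,linorder}"
      using sum_squares_bound[of "norm x" 1] norm_ge_zero[of x]
      by (simp only: power_one mult_1_right)
    then show "AE x in \<mu>. norm x \<le> norm (1 + (norm x)\<^sup>2)" by simp
  qed measurable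
  have mean_u: "(\<integral>x. x \<bullet> u i \<partial>\<mu>) = 0" for i
    using integral_inner_left[of "u i" \<mu> "\<lambda>x. x"] id mean by simp
  let ?N = "measure_pmf (pmf_of_set (UNIV :: ('d::{finite,linorder} \<times> bool) set))"
  let ?P = "\<mu> \<Otimes>\<^sub>M ?N"
  interpret P: pair_prob_space \<mu> ?N ..
  \<comment> \<open>Whitened coordinates of \<open>x\<close>; directions in which \<open>\<mu>\<close> is degenerate are filled with
    independent noise.\<close>
  define \<eta> where "\<eta> i p = (if ?a $ i = 0 then sign_noise i (snd p) else (fst p \<bullet> u i) / sqrt (?a $ i))" for i p
  have noise_int: "integrable ?N f" for f :: "_ \<Rightarrow> real"
    by (intro integrable_measure_pmf_finite) simp
  note int_u = centered_P2_integrable_inner_mult[OF \<mu>]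
  have int_u1: "integrable \<mu> (\<lambda>x. x \<bullet> u i)" for i
    using id by simp
  have [measurable]: "sign_noise i \<in> borel_measurable ?N" for i by simp
  have \<eta>_meas[measurable]: "\<eta> i \<in> borel_measurable ?P" for i
    unfolding \<eta>_def by measurable
  have \<eta>: "integrable ?P (\<eta> i) \<and> (\<integral>p. \<eta> i p \<partial>?P) = 0" for i
  proof (cases "?a $ i = 0")
    case True
    then have "\<eta> i = (\<lambda>p. 1 * sign_noise i (snd p))" by (auto simp: \<eta>_def)
    then show ?thesis
      using P.product_expectation[of "\<lambda>_. 1" "sign_noise i"] noise_int by (simp add: sign_noise_mean)
  next
    case False
    then have "\<eta> i = (\<lambda>p. (fst p \<bullet> u i) * (1 / sqrt (?a $ i)))" by (auto simp: \<eta>_def)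
    then show ?thesis
      using P.product_expectation[of "\<lambda>x. x \<bullet> u i" "\<lambda>_. 1 / sqrt (?a $ i)"] int_u1 by (simp add: mean_u)
  qed
  have uu: "integrable ?P (\<lambda>p. (fst p \<bullet> u i) * (fst p \<bullet> u j)) \<and>
      (\<integral>p. (fst p \<bullet> u i) * (fst p \<bullet> u j) \<partial>?P) = (if i = j then ?a $ i else 0)" for i j
    using P.product_expectation[of "\<lambda>x. (x \<bullet> u i) * (x \<bullet> u j)" "\<lambda>_. 1"] int_u[of "u i" "u j"]
    by (simp add: Eu)
  \<comment> \<open>The formula includes \<open>?a $ j = 0\<close>: independent centered noise gives
    0, which for \<open>i = j\<close> is also \<open>sqrt (?a $ i)\<close>.\<close>
  have u\<eta>: "integrable ?P (\<lambda>p. (fst p \<bullet> u i) * \<eta> j p) \<and>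
      (\<integral>p. (fst p \<bullet> u i) * \<eta> j p \<partial>?P) = (if i = j then sqrt (?a $ i) else 0)" for i j
  proof (cases "?a $ j = 0")
    case True
    then have "(\<lambda>p. (fst p \<bullet> u i) * \<eta> j p) = (\<lambda>p. (fst p \<bullet> u i) * sign_noise j (snd p))"
      by (auto simp: \<eta>_def)
    then show ?thesis
      using P.product_expectation[of "\<lambda>x. x \<bullet> u i" "sign_noise j"] noise_int int_u1 True
      by (simp add: mean_u)
  next
    case False
    then have "(\<lambda>p. (fst p \<bullet> u i) * \<eta> j p) = (\<lambda>p. ((fst p \<bullet> u i) * (fst p \<bullet> u j)) / sqrt (?a $ j))"
      by (auto simp: \<eta>_def)
    then show ?thesis
      using uu[of i j] ann[of j] by (simp add: real_div_sqrt)
  qed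
  have \<eta>\<eta>: "integrable ?P (\<lambda>p. \<eta> i p * \<eta> j p) \<and>
      (\<integral>p. \<eta> i p * \<eta> j p \<partial>?P) = (if i = j then 1 else 0)" for i j
  proof -
    \<comment> \<open>One nondegenerate index reduces the claim to \<open>u\<eta>\<close>; the
      covariance of the noise enters when both variances vanish.\<close>
    consider "?a $ i = 0" "?a $ j = 0" | "?a $ i \<noteq> 0" | "?a $ j \<noteq> 0" by blast
    then show ?thesis
    proof cases
      case 1
      then have "(\<lambda>p. \<eta> i p * \<eta> j p) = (\<lambda>p. 1 * (sign_noise i (snd p) * sign_noise j (snd p)))"
        by (auto simp: \<eta>_def)
      then show ?thesis
        using P.product_expectation[of "\<lambda>_. 1" "\<lambda>\<omega>. sign_noise i \<omega> * sign_noise j \<omega>"] noise_int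
        by (simp add: sign_noise_covariance \<mu>.prob_space)
    next
      case 2
      then have "(\<lambda>p. \<eta> i p * \<eta> j p) = (\<lambda>p. ((fst p \<bullet> u i) * \<eta> j p) / sqrt (?a $ i))"
        by (auto simp: \<eta>_def)
      then show ?thesis using u\<eta>[of i j] 2 by auto
    next
      case 3
      then have "(\<lambda>p. \<eta> i p * \<eta> j p) = (\<lambda>p. ((fst p \<bullet> u j) * \<eta> i p) / sqrt (?a $ j))"
        by (auto simp: \<eta>_def)
      then show ?thesis using u\<eta>[of j i] 3 by auto
    qed
  qed
  \<comment> \<open>In a nondegenerate direction this scales the coordinate by
    \<open>sqrt (v $ i / ?a $ i)\<close>; in a degenerate one it inserts noise of variance
    \<open>v $ i\<close>.\<close>
  define T where "T p = (\<Sum>i\<in>UNIV. (sqrt (v $ i) * \<eta> i p) *\<^sub>R u i)" for p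
  have T_meas[measurable]: "T \<in> borel_measurable ?P"
    unfolding T_def by measurable
  have T_u: "T p \<bullet> u j = sqrt (v $ j) * \<eta> j p" for p j
    by (simp add: T_def inner_sum_left orthonormal_family_inner[OF u] if_distrib[of "\<lambda>x. _ * x"] cong: if_cong)
  have T_sq: "(norm (T p))\<^sup>2 = (\<Sum>i\<in>UNIV. v $ i * (\<eta> i p * \<eta> i p))" for p
    unfolding power2_norm_eq_inner orthonormal_family_parseval[OF u, of "T p" "T p"] T_u
    by (intro sum.cong refl) (metis abs_of_nonneg mult.assoc mult.left_commute real_sqrt_mult_self v)
  define \<nu> where "\<nu> = distr ?P borel T"
  have \<nu>: "\<nu> \<in> centered_P2"
    unfolding centered_P2_def mem_Collect_eq
  proof (intro conjI)
    show "prob_space \<nu>" unfolding \<nu>_def by (rule P.prob_space_distr) measurable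
    show "integrable \<nu> (\<lambda>x. (norm x)\<^sup>2)"
      unfolding \<nu>_def using \<eta>\<eta> by (subst integrable_distr_eq) (auto simp: T_sq)
    have "(\<integral>x. x \<partial>\<nu>) = (\<integral>p. T p \<partial>?P)"
      unfolding \<nu>_def by (subst integral_distr) auto
    also have "\<dots> = 0"
      unfolding T_def using \<eta> by (subst Bochner_Integration.integral_sum) auto
    finally show "(\<integral>x. x \<partial>\<nu>) = 0" .
  qed (simp add: \<nu>_def)
  have "eigenvalue_vec (second_moment \<nu>) = v"
  proof (rule eigenvalue_vec_second_momentI[OF \<nu> u _ sorted])
    fix i j
    have "(\<integral>x. (x \<bullet> u i) * (x \<bullet> u j) \<partial>\<nu>) = (\<integral>p. (sqrt (v $ i) * sqrt (v $ j)) * (\<eta> i p * \<eta> j p) \<partial>?P)"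
      unfolding \<nu>_def by (subst integral_distr) (auto simp: T_u mult_ac)
    also have "\<dots> = (if i = j then v $ i else 0)"
      using \<eta>\<eta>[of i j] v by simp
    finally show "(\<integral>x. (x \<bullet> u i) * (x \<bullet> u j) \<partial>\<nu>) = (if i = j then v $ i else 0)" .
  qed
  moreover have "W2 \<mu> \<nu> \<le> ennreal (norm (sqrt_vec ?a - sqrt_vec v))"
  proof -
    define \<pi> where "\<pi> = distr ?P (borel \<Otimes>\<^sub>M borel) (\<lambda>p. (fst p, T p))"
    \<comment> \<open>The target \<open>borel\<close> is exchanged for \<open>\<mu>\<close>, which
      has the same sets, so that the first marginal of the product is recognized.\<close>
    have "distr \<pi> borel fst = distr ?P \<mu> fst"
      unfolding \<pi>_def by (subst distr_distr) (auto simp: comp_def intro!: distr_cong sets_\<mu>[symmetric])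
    also have "\<dots> = \<mu>" by (rule measure_pmf.distr_pair_fst)
    finally have "\<pi> \<in> couplings \<mu> \<nu>"
      unfolding couplings_def \<nu>_def
      by (auto simp: \<pi>_def distr_distr comp_def intro!: P.prob_space_distr)
    then have "W2 \<mu> \<nu> \<le> ennsqrt (\<integral>\<^sup>+(x, y). ennreal ((norm (x - y))\<^sup>2) \<partial>\<pi>)"
      unfolding W2_def by (rule INF_lower)
    also have "(\<integral>\<^sup>+(x, y). ennreal ((norm (x - y))\<^sup>2) \<partial>\<pi>) = (\<integral>\<^sup>+p. ennreal ((norm (fst p - T p))\<^sup>2) \<partial>?P)"
      unfolding \<pi>_def by (subst nn_integral_distr) auto
    also have "\<dots> = ennreal ((norm (sqrt_vec ?a - sqrt_vec v))\<^sup>2)"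
    proof -
      \<comment> \<open>Both points are expanded in the same basis, so no overlaps appear, and the
        \<open>i\<close>-th term has mean
        \<open>(sqrt (?a $ i) - sqrt (v $ i))\<^sup>2\<close>.\<close>
      have expand: "(norm (fst p - T p))\<^sup>2 = (\<Sum>i\<in>UNIV. (fst p \<bullet> u i) * (fst p \<bullet> u i)
          - 2 * sqrt (v $ i) * ((fst p \<bullet> u i) * \<eta> i p) + v $ i * (\<eta> i p * \<eta> i p))" for p
        unfolding power2_norm_eq_inner orthonormal_family_parseval[OF u, of "fst p - T p" "fst p - T p"]
      proof (intro sum.cong refl)
        fix i
        have square: "(x - r * e) * (x - r * e) = x * x - 2 * r * (x * e) + (r * r) * (e * e)" for x r e :: real
          by (simp add: algebra_simps)
        show "((fst p - T p) \<bullet> u i) * ((fst p - T p) \<bullet> u i) = (fst p \<bullet> u i) * (fst p \<bullet> u i)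
          - 2 * sqrt (v $ i) * ((fst p \<bullet> u i) * \<eta> i p) + v $ i * (\<eta> i p * \<eta> i p)"
          unfolding inner_diff_left T_u by (subst square) (simp add: v)
      qed
      have int: "integrable ?P (\<lambda>p. (norm (fst p - T p))\<^sup>2)"
        unfolding expand using uu u\<eta> \<eta>\<eta> by auto
      have "(\<integral>p. (norm (fst p - T p))\<^sup>2 \<partial>?P) = (\<Sum>i\<in>UNIV. ?a $ i - 2 * sqrt (v $ i) * sqrt (?a $ i) + v $ i)"
        unfolding expand using uu u\<eta> \<eta>\<eta> by simp
      also have "\<dots> = (norm (sqrt_vec ?a - sqrt_vec v))\<^sup>2"
        unfolding norm_sqrt_vec_diff_square using ann v
        by (simp add: power2_diff algebra_simps)
      finally show ?thesis
        using nn_integral_eq_integral[OF int] by simp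
    qed
    also have "ennsqrt \<dots> = ennreal (norm (sqrt_vec ?a - sqrt_vec v))"
      by (simp add: ennsqrt_ennreal)
    finally show ?thesis .
  qed
  ultimately show ?thesis using \<nu> by blast
qed

section \<open>Sorting the target vector\<close>

text \<open>A permutation preserves the sum of the entries, so only the cross term changes, and it
  is largest when both vectors are sorted alike.\<close>

lemma norm_sqrt_vec_diff_sorted_le:
  fixes a v :: "real ^ 'd::{finite,linorder}"
  assumes "\<And>i. 0 \<le> a $ i" and "\<And>i. 0 \<le> v $ i" and p: "p permutes UNIV"
    and a: "\<And>i j. i \<le> j \<Longrightarrow> a $ j \<le> a $ i" and vp: "\<And>i j. i \<le> j \<Longrightarrow> v $ p j \<le> v $ p i"
  shows "norm (sqrt_vec a - sqrt_vec (\<chi> i. v $ p i)) \<le> norm (sqrt_vec a - sqrt_vec v)"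
proof -
  have bij: "bij p" using p by (rule permutes_bij)
  have inv: "p (inv p i) = i" for i using bij by (simp add: bij_is_surj surj_f_inv_f)
  have eq: "i = p j \<longleftrightarrow> inv p i = j" for i j
    using bij by (metis bij_inv_eq_iff)
  \<comment> \<open>The unsorted sum is written with sorted entries and a permutation matrix, which
    is the \<open>D\<close> of \<open>doubly_substochastic_sum_le\<close>.\<close>
  have "(\<Sum>i\<in>UNIV. sqrt (a $ i) * sqrt (v $ i))
      = (\<Sum>i\<in>UNIV. \<Sum>j\<in>UNIV. sqrt (a $ i) * sqrt (v $ p j) * (if i = p j then 1 else 0))"
    by (simp add: eq inv if_distrib[of "\<lambda>x. _ * x"] cong: if_cong)
  also have "\<dots> \<le> (\<Sum>i\<in>UNIV. sqrt (a $ i) * sqrt (v $ p i))"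
    using assms(1,2) a vp
    by (intro doubly_substochastic_sum_le) (auto simp: monotone_on_def eq, simp add: eq[symmetric])
  finally have le: "(\<Sum>i\<in>UNIV. sqrt (a $ i) * sqrt (v $ i)) \<le> (\<Sum>i\<in>UNIV. sqrt (a $ i) * sqrt (v $ p i))" .
  have sum_p: "(\<Sum>i\<in>UNIV. v $ p i) = (\<Sum>i\<in>UNIV. v $ i)"
    using sum.permute[OF p, of "\<lambda>i. v $ i"] by (simp add: comp_def)
  have sq: "(norm (sqrt_vec a - sqrt_vec w))\<^sup>2
      = (\<Sum>i\<in>UNIV. a $ i) + (\<Sum>i\<in>UNIV. w $ i) - 2 * (\<Sum>i\<in>UNIV. sqrt (a $ i) * sqrt (w $ i))"
    if "\<And>i. 0 \<le> w $ i" for w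
    using that assms(1)
    by (simp add: norm_sqrt_vec_diff_square power2_diff sum.distrib sum_subtractf sum_distrib_left mult_ac)
  have "(norm (sqrt_vec a - sqrt_vec (\<chi> i. v $ p i)))\<^sup>2 \<le> (norm (sqrt_vec a - sqrt_vec v))\<^sup>2"
    using le assms(2) by (simp add: sq sum_p)
  then show ?thesis by (rule power2_le_imp_le) simp
qed

lemma exists_sorting_permutation:
  fixes v :: "real ^ 'd::{finite,linorder}"
  shows "\<exists>p. p permutes UNIV \<and> (\<forall>i j. i \<le> j \<longrightarrow> v $ p j \<le> v $ p i)"
  using finite_sorted_enumeration[of "UNIV :: 'd::{finite,linorder} set" UNIV "\<lambda>i. v $ i"]
  by simp (metis UNIV_I bij_imp_permutes)

theorem theoremA6:
  fixes G :: "(real ^ 'd::{finite,linorder}) set" and \<mu> :: "(real ^ 'd::{finite,linorder}) measure"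
  assumes "G \<subseteq> nonneg_vectors" and "symmetric_set G"
    and "\<mu> \<in> centered_P2"
  shows "W2_set \<mu> (spectral_measures G) =
    (INF v\<in>G. ennreal (norm (sqrt_vec (eigenvalue_vec (second_moment \<mu>)) - sqrt_vec v)))"
proof (rule antisym)
  let ?a = "eigenvalue_vec (second_moment \<mu>)"
  \<comment> \<open>Arguing by \<open>INF_greatest\<close> in both directions also covers empty
    \<open>G\<close>, where both infima are \<top>.\<close>
  show "(INF v\<in>G. ennreal (norm (sqrt_vec ?a - sqrt_vec v))) \<le> W2_set \<mu> (spectral_measures G)"
    unfolding W2_set_def
  proof (rule INF_greatest)
    fix \<nu> assume "\<nu> \<in> spectral_measures G"
    then have \<nu>: "\<nu> \<in> centered_P2" "eigenvalue_vec (second_moment \<nu>) \<in> G"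
      by (auto simp: spectral_measures_def)
    show "(INF v\<in>G. ennreal (norm (sqrt_vec ?a - sqrt_vec v))) \<le> W2 \<mu> \<nu>"
      by (rule INF_lower2[OF \<nu>(2)]) (rule W2_ge_eigenvalue_distance[OF assms(3) \<nu>(1)])
  qed
  have a_sorted: "?a $ j \<le> ?a $ i" if "i \<le> j" for i j
    by (rule eigenvalue_vec_second_moment_sorted[OF assms(3) that])
  have a_nonneg: "0 \<le> ?a $ i" for i
    by (rule eigenvalue_vec_second_moment_nonneg[OF assms(3)])
  show "W2_set \<mu> (spectral_measures G) \<le> (INF v\<in>G. ennreal (norm (sqrt_vec ?a - sqrt_vec v)))"
  proof (rule INF_greatest)
    fix v assume v: "v \<in> G"
    then have v_nonneg: "0 \<le> v $ i" for i
      using assms(1) by (auto simp: nonneg_vectors_def)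
    obtain p where p: "p permutes UNIV" "\<forall>i j. i \<le> j \<longrightarrow> v $ p j \<le> v $ p i"
      using exists_sorting_permutation by blast
    \<comment> \<open>The spectrum of a second-moment matrix is sorted, so \<open>v\<close> itself
      may not occur as one; symmetry of \<open>G\<close> keeps the sorted rearrangement in
      \<open>G\<close>.\<close>
    let ?w = "\<chi> i. v $ p i"
    have w: "?w \<in> G"
      using assms(2) v p(1) by (auto simp: symmetric_set_def)
    obtain \<nu> where \<nu>: "\<nu> \<in> centered_P2" "eigenvalue_vec (second_moment \<nu>) = ?w"
      and le: "W2 \<mu> \<nu> \<le> ennreal (norm (sqrt_vec ?a - sqrt_vec ?w))"
      using exists_measure_with_eigenvalues[OF assms(3), of ?w] v_nonneg p(2) by auto
    have "\<nu> \<in> spectral_measures G"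
      using \<nu> w by (simp add: spectral_measures_def)
    then have "W2_set \<mu> (spectral_measures G) \<le> W2 \<mu> \<nu>"
      unfolding W2_set_def by (rule INF_lower)
    also note le
    also have "norm (sqrt_vec ?a - sqrt_vec ?w) \<le> norm (sqrt_vec ?a - sqrt_vec v)"
      using p a_sorted a_nonneg v_nonneg by (intro norm_sqrt_vec_diff_sorted_le) auto
    finally show "W2_set \<mu> (spectral_measures G) \<le> ennreal (norm (sqrt_vec ?a - sqrt_vec v))"
      by (simp add: ennreal_leI)
  qed
qed

end
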